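(* Let $x \in \mathbb{R}^{N\times N}$ be an image, let $s\ge 1$ be a patch stride dividing $N$, let $X \in \mathbb{R}^{K^2\times M^2}$ be the patch matrix of $x$ formed from $K\times K$ patches with stride $s$ (with periodic or zero boundary conditions), and let $W \in \mathbb{R}^{N_c\times K^2}$. Then the rows of $WX$ are obtained by passing $x$ through the $N_c$-channel, 2D FIR multirate analysis filter bank $\mathcal{H}=(\mathcal{H}_1,\dots,\mathcal{H}_{N_c})$ generated by $W$ with stride $s$, and vectorizing the channel outputs. That is, for every $i=1,\dots,N_c$, the $i$-th row of $WX$ is the vectorization of $\mathcal{H}_i x \in \mathbb{R}^{M\times M}$: for all $0\le a,b\le M-1$, $[WX]_{i,(a,b)} = (h_i * x)[sa, sb]$.
   Context: Images are indexed as $x[n_1,n_2]$, $0\le n_1,n_2\le N-1$, and $1 \le K\le N$. The image is extended to all of $\mathbb{Z}^2$ either $N$-periodically in each coordinate (periodic boundary conditions, with $M=N/s$) or by zero (zero boundary conditions, with $M\ge 1$ the number of patch positions per dimension). Patch matrix: columns of $X$ are indexed by patch positions $(a,b)$, $0\le a,b\le M-1$, and rows by $(k_1,k_2)$, $0\le k_1,k_2\le K-1$ (both index sets ordered in a fixed way, e.g. lexicographically). The column $(a,b)$ is the vectorized, flipped $K\times K$ patch $X_{(k_1,k_2),(a,b)} = x[sa-k_1,\, sb-k_2]$ (so the lower-right pixel of the first patch is $x[0,0]$). Columns of $W$ are indexed by the same pairs $(k_1,k_2)$. Filter bank: the $i$-th filter has impulse response $h_i$ with $h_i[k_1,k_2]=W_{i,(k_1,k_2)}$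 for $0\le k_1,k_2\le K-1$ and $0$ otherwise (the $i$-th row of $W$ reshaped into a $K\times K$ array and zero-padded). The $i$-th channel operator $\mathcal{H}_i:\mathbb{R}^{N\times N}\to\mathbb{R}^{M\times M}$ is $[\mathcal{H}_i x]_{a,b} = (h_i*x)[sa,sb]$, where $(h_i * x)[n_1,n_2]=\sum_{k_1,k_2=0}^{K-1} h_i[k_1,k_2]\,x[n_1-k_1,n_2-k_2]$ with $x$ extended to all of $\mathbb{Z}^2$ by the same boundary condition used to form $X$, i.e. either $N$-periodically in each coordinate or by zero (cyclic convolution for the periodic extension, linear convolution for the zero extension). The filter bank is $\mathcal{H}x=\sum_{i=1}^{N_c} e_i\otimes \mathcal{H}_i x$, where $e_i$ is the $i$-th standard basis vector of $\mathbb{R}^{N_c}$. *)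

theory Defs
  imports "Jordan_Normal_Form.Matrix"
begin

text \<open>
  All indices are 0-based; in particular the channels are numbered \<open>0, \<dots>, N\<^sub>c - 1\<close>.
  An image is a real matrix, with pixel \<open>x[n\<^sub>1,n\<^sub>2]\<close> given by \<open>x $$ (n\<^sub>1,n\<^sub>2)\<close>.
\<close>

datatype boundary = Periodic | Zero

fun extend :: "boundary \<Rightarrow> real mat \<Rightarrow> int \<Rightarrow> int \<Rightarrow> real" where
  "extend Periodic x n1 n2 =
     x $$ (nat (n1 mod int (dim_row x)), nat (n2 mod int (dim_col x)))"
| "extend Zero x n1 n2 =
     (if 0 \<le> n1 \<and> n1 < int (dim_row x) \<and> 0 \<le> n2 \<and> n2 < int (dim_col x)
      then x $$ (nat n1, nat n2) else 0)"

text \<open>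
  An ordering of the index pairs \<open>{0..<n} \<times> {0..<n}\<close>: \<open>\<sigma> r\<close> is the pair listed at
  position \<open>r\<close>. The lexicographic order is \<open>\<lambda>r. (r div n, r mod n)\<close>.
\<close>

definition pair_ordering :: "nat \<Rightarrow> (nat \<Rightarrow> nat \<times> nat) \<Rightarrow> bool" where
  "pair_ordering n \<sigma> \<longleftrightarrow> bij_betw \<sigma> {..<n\<^sup>2} ({..<n} \<times> {..<n})"

definition position :: "nat \<Rightarrow> (nat \<Rightarrow> nat \<times> nat) \<Rightarrow> nat \<times> nat \<Rightarrow> nat" where
  "position n \<sigma> = inv_into {..<n\<^sup>2} \<sigma>"

definition vectorize :: "(nat \<Rightarrow> nat \<times> nat) \<Rightarrow> real mat \<Rightarrow> real vec" where
  "vectorize \<sigma> A = vec (dim_row A * dim_col A) (\<lambda>r. A $$ \<sigma> r)"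

text \<open>
  \<open>\<kappa>\<close> orders the pairs \<open>(k\<^sub>1,k\<^sub>2)\<close> within a \<open>K \<times> K\<close> patch (rows of the patch matrix), and
  \<open>\<tau>\<close> orders the \<open>M \<times> M\<close> patch positions \<open>(a,b)\<close> (its columns).
\<close>

definition patch_matrix ::
  "boundary \<Rightarrow> nat \<Rightarrow> nat \<Rightarrow> nat \<Rightarrow> (nat \<Rightarrow> nat \<times> nat) \<Rightarrow> (nat \<Rightarrow> nat \<times> nat)
     \<Rightarrow> real mat \<Rightarrow> real mat" where
  "patch_matrix bc s K M \<kappa> \<tau> x =
     mat (K\<^sup>2) (M\<^sup>2) (\<lambda>(r, c).
       case \<kappa> r of (k1, k2) \<Rightarrow> case \<tau> c of (a, b) \<Rightarrow>
         extend bc x (int s * int a - int k1) (int s * int b - int k2))"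

definition impulse_response ::
  "nat \<Rightarrow> (nat \<Rightarrow> nat \<times> nat) \<Rightarrow> real mat \<Rightarrow> nat \<Rightarrow> int \<Rightarrow> int \<Rightarrow> real" where
  "impulse_response K \<kappa> W i k1 k2 =
     (if 0 \<le> k1 \<and> k1 < int K \<and> 0 \<le> k2 \<and> k2 < int K
      then W $$ (i, position K \<kappa> (nat k1, nat k2)) else 0)"

definition conv2 ::
  "boundary \<Rightarrow> nat \<Rightarrow> (int \<Rightarrow> int \<Rightarrow> real) \<Rightarrow> real mat \<Rightarrow> int \<Rightarrow> int \<Rightarrow> real" where
  "conv2 bc K h x n1 n2 =
     (\<Sum>k1<K. \<Sum>k2<K. h (int k1) (int k2) * extend bc x (n1 - int k1) (n2 - int k2))"

definition channel ::
  "boundary \<Rightarrow> nat \<Rightarrow> nat \<Rightarrow> nat \<Rightarrow> (nat \<Rightarrow> nat \<times> nat) \<Rightarrow> real mat \<Rightarrow> nat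
     \<Rightarrow> real mat \<Rightarrow> real mat" where
  "channel bc s K M \<kappa> W i x =
     mat M M (\<lambda>(a, b).
       conv2 bc K (impulse_response K \<kappa> W i) x (int s * int a) (int s * int b))"

text \<open>
  Elements of \<open>\<real>\<^bsup>n\<^esup> \<otimes> \<real>\<^bsup>M\<times>M\<^esup>\<close> are represented as three-way arrays \<open>T j a b\<close>, extended
  by zero outside their index range.
\<close>

definition tensor :: "real vec \<Rightarrow> real mat \<Rightarrow> nat \<Rightarrow> nat \<Rightarrow> nat \<Rightarrow> real" where
  "tensor v A j a b =
     (if j < dim_vec v \<and> a < dim_row A \<and> b < dim_col A then v $ j * A $$ (a, b) else 0)"

definition filter_bank ::
  "boundary \<Rightarrow> nat \<Rightarrow> nat \<Rightarrow> nat \<Rightarrow> (nat \<Rightarrow> nat \<times> nat) \<Rightarrow> real mat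
     \<Rightarrow> real mat \<Rightarrow> nat \<Rightarrow> nat \<Rightarrow> nat \<Rightarrow> real" where
  "filter_bank bc s K M \<kappa> W x j a b =
     (\<Sum>i<dim_row W. tensor (unit_vec (dim_row W) i) (channel bc s K M \<kappa> W i x) j a b)"

definition channel_output :: "nat \<Rightarrow> (nat \<Rightarrow> nat \<Rightarrow> nat \<Rightarrow> real) \<Rightarrow> nat \<Rightarrow> real mat" where
  "channel_output M T i = mat M M (\<lambda>(a, b). T i a b)"

end

theory Submission
  imports Defs
begin

text \<open>Entry (i, c) of the product is the sum over r of \<open>W $$ (i, r)\<close> times the
  extended image at (sa - k1, sb - k2), where (k1, k2) = \<open>\<kappa> r\<close> and (a, b) =
  \<open>\<tau> c\<close>. Since patches are stored flipped, these are exactly the sample points of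
  the convolution at (sa, sb); both sides use the same extension, so the boundary condition enters
  them identically. Only bookkeeping remains: \<open>conv2_impulse_response\<close> flattens the
  double sum along the bijection \<kappa>, \<open>row_eq_vectorize\<close> carries the entrywise
  identity along \<tau> to whole rows, and \<open>channel_output_filter_bank\<close> recovers one
  channel from the tensor sum.\<close>

lemma pair_orderingD:
  assumes "pair_ordering n \<sigma>"
  shows "r < n\<^sup>2 \<Longrightarrow> \<sigma> r \<in> {..<n} \<times> {..<n}"
    and "r < n\<^sup>2 \<Longrightarrow> position n \<sigma> (\<sigma> r) = r"
    and "p \<in> {..<n} \<times> {..<n} \<Longrightarrow> position n \<sigma> p < n\<^sup>2"
    and "p \<in> {..<n} \<times> {..<n} \<Longrightarrow> \<sigma> (position n \<sigma> p) = p"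
proof -
  have bij: "bij_betw \<sigma> {..<n\<^sup>2} ({..<n} \<times> {..<n})"
    using assms by (simp add: pair_ordering_def)
  show "\<sigma> r \<in> {..<n} \<times> {..<n}" if "r < n\<^sup>2"
    using bij_betwE[OF bij] that by blast
  show "position n \<sigma> (\<sigma> r) = r" if "r < n\<^sup>2"
    unfolding position_def using bij_betw_inv_into_left[OF bij] that by simp
  show "\<sigma> (position n \<sigma> p) = p" if "p \<in> {..<n} \<times> {..<n}"
    unfolding position_def using bij_betw_inv_into_right[OF bij that] .
  show "position n \<sigma> p < n\<^sup>2" if "p \<in> {..<n} \<times> {..<n}"
    unfolding position_def using bij_betwE[OF bij_betw_inv_into[OF bij]] that by blast
qed

text \<open>Filter taps are read from W through \<open>position\<close>, the inverse of \<kappa>.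
  Pulling the sum over pairs back along \<kappa> therefore cancels the two and leaves the flat sum
  that occurs in a matrix product.\<close>

lemma conv2_impulse_response:
  assumes "pair_ordering K \<kappa>"
  shows "conv2 bc K (impulse_response K \<kappa> W i) x n1 n2 =
    (\<Sum>r<K\<^sup>2. W $$ (i, r) *
       (case \<kappa> r of (k1, k2) \<Rightarrow> extend bc x (n1 - int k1) (n2 - int k2)))"
proof -
  let ?e = "\<lambda>(k1, k2). extend bc x (n1 - int k1) (n2 - int k2)"
  \<comment> \<open>Both summation indices stay below K, so the zero-padding branch of the impulse
    response is never reached.\<close>
  have "conv2 bc K (impulse_response K \<kappa> W i) x n1 n2 =
      (\<Sum>k1<K. \<Sum>k2<K. W $$ (i, position K \<kappa> (k1, k2)) * ?e (k1, k2))"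
    by (simp add: conv2_def impulse_response_def)
  also have "\<dots> = (\<Sum>p\<in>{..<K} \<times> {..<K}. W $$ (i, position K \<kappa> p) * ?e p)"
    by (simp add: sum.cartesian_product case_prod_beta)
  also have "\<dots> = (\<Sum>r<K\<^sup>2. W $$ (i, position K \<kappa> (\<kappa> r)) * ?e (\<kappa> r))"
    using assms by (intro sum.reindex_bij_betw[symmetric]) (simp add: pair_ordering_def)
  also have "\<dots> = (\<Sum>r<K\<^sup>2. W $$ (i, r) * ?e (\<kappa> r))"
    by (intro sum.cong) (auto simp: pair_orderingD(2)[OF assms])
  finally show ?thesis .
qed

lemma mult_patch_matrix_index:
  assumes "pair_ordering K \<kappa>" and "W \<in> carrier_mat Nc (K\<^sup>2)" and "i < Nc" and "c < M\<^sup>2"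
    and "\<tau> c = (a, b)"
  shows "(W * patch_matrix bc s K M \<kappa> \<tau> x) $$ (i, c) =
    conv2 bc K (impulse_response K \<kappa> W i) x (int s * int a) (int s * int b)"
  using assms
  \<comment> \<open>\<open>scalar_prod\<close> sums over \<open>{0..<n}\<close> and the flattened
    convolution over \<open>{..<n}\<close>; the flipped rule brings both to the first form.\<close>
  by (simp add: conv2_impulse_response patch_matrix_def scalar_prod_def
      flip: atLeast0LessThan)

text \<open>Every column c is the position of the pair \<open>\<tau> c\<close>, so agreement at the
  positions of all pairs already covers the whole row.\<close>

lemma row_eq_vectorize:
  assumes "pair_ordering M \<tau>" and "A \<in> carrier_mat n (M\<^sup>2)" and "i < n" and "B \<in> carrier_mat M M"
    and "\<And>a b. a < M \<Longrightarrow> b < M \<Longrightarrow> A $$ (i, position M \<tau> (a, b)) = B $$ (a, b)"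
  shows "row A i = vectorize \<tau> B"
proof (rule eq_vecI)
  show "dim_vec (row A i) = dim_vec (vectorize \<tau> B)"
    using assms by (simp add: vectorize_def power2_eq_square)
next
  fix c
  assume "c < dim_vec (vectorize \<tau> B)"
  then have c: "c < M\<^sup>2"
    using assms by (simp add: vectorize_def power2_eq_square)
  obtain a b where ab: "\<tau> c = (a, b)" "a < M" "b < M"
    using pair_orderingD(1)[OF assms(1) c] by auto
  have "A $$ (i, c) = B $$ (a, b)"
    using assms(5)[OF ab(2,3)] pair_orderingD(2)[OF assms(1) c] ab(1) by simp
  then show "row A i $ c = vectorize \<tau> B $ c"
    using assms(2-4) c ab(1) by (simp add: vectorize_def power2_eq_square)
qed

text \<open>The tensor of the j-th unit vector with an image vanishes on every slice except the
  j-th, so slice i of the sum retains only the term of channel i.\<close>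

lemma channel_output_filter_bank:
  assumes "i < dim_row W"
  shows "channel_output M (filter_bank bc s K M \<kappa> W x) i = channel bc s K M \<kappa> W i x"
proof (rule eq_matI)
  fix a b
  assume "a < dim_row (channel bc s K M \<kappa> W i x)" "b < dim_col (channel bc s K M \<kappa> W i x)"
  then have ab: "a < M" "b < M"
    by (auto simp: channel_def)
  have "filter_bank bc s K M \<kappa> W x i a b =
      (\<Sum>j<dim_row W. if j = i then channel bc s K M \<kappa> W j x $$ (a, b) else 0)"
    unfolding filter_bank_def using assms ab
    by (intro sum.cong) (auto simp: tensor_def unit_vec_def channel_def)
  also have "\<dots> = channel bc s K M \<kappa> W i x $$ (a, b)"
    using assms by simp
  finally show "channel_output M (filter_bank bc s K M \<kappa> W x) i $$ (a, b) =
      channel bc s K M \<kappa> W i x $$ (a, b)"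
    using ab by (simp add: channel_output_def)
qed (auto simp: channel_output_def channel_def)

theorem proposition1:
  fixes N K M s Nc :: nat
    and bc :: boundary
    and \<kappa> \<tau> :: "nat \<Rightarrow> nat \<times> nat"
    and x X W :: "real mat"
  assumes x: "x \<in> carrier_mat N N"
    and K: "1 \<le> K" "K \<le> N"
    and s: "1 \<le> s" "s dvd N"
    and M_periodic: "bc = Periodic \<Longrightarrow> M = N div s"
    and M_zero: "bc = Zero \<Longrightarrow> 1 \<le> M"
    and \<kappa>: "pair_ordering K \<kappa>"
    and \<tau>: "pair_ordering M \<tau>"
    and X: "X = patch_matrix bc s K M \<kappa> \<tau> x"
    and W: "W \<in> carrier_mat Nc (K\<^sup>2)"
  shows "W * X \<in> carrier_mat Nc (M\<^sup>2) \<and>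
    (\<forall>i<Nc.
       row (W * X) i = vectorize \<tau> (channel_output M (filter_bank bc s K M \<kappa> W x) i) \<and>
       row (W * X) i = vectorize \<tau> (channel bc s K M \<kappa> W i x) \<and>
       (\<forall>a<M. \<forall>b<M. (W * X) $$ (i, position M \<tau> (a, b)) =
          conv2 bc K (impulse_response K \<kappa> W i) x (int s * int a) (int s * int b)))"
proof -
  have WX: "W * X \<in> carrier_mat Nc (M\<^sup>2)"
    using W X by (simp add: patch_matrix_def)
  have entry: "(W * X) $$ (i, position M \<tau> (a, b)) =
      conv2 bc K (impulse_response K \<kappa> W i) x (int s * int a) (int s * int b)"
    if "i < Nc" "a < M" "b < M" for i a b
    \<comment> \<open>The column index \<open>position M \<tau> (a, b)\<close> is in range, and
      \<tau> sends it back to (a, b).\<close>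
    unfolding X using that
    by (intro mult_patch_matrix_index[OF \<kappa> W]) (auto simp: pair_orderingD[OF \<tau>])
  have "row (W * X) i = vectorize \<tau> (channel bc s K M \<kappa> W i x)" if "i < Nc" for i
    by (rule row_eq_vectorize[OF \<tau> WX that]) (simp_all add: channel_def entry that)
  then show ?thesis
    using WX W entry by (auto simp: channel_output_filter_bank)
qed

end
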